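(* Let $X$ be a real Banach space with $X\neq\{0\}$. If the dual space $X^*$ has the weak$^*$ symmetric strong diameter $2$ property ($w^*$-SSD$2$P), then $X$ is decomposably octahedral (DOH).
   Context: All Banach spaces are real and nontrivial ($\neq\{0\}$). For a Banach space $X$, $B_X$, $S_X$ and $X^*$ denote its closed unit ball, unit sphere and (topological) dual space. A weak$^*$ slice of $B_{X^*}$ is a set of the form $S(B_{X^*},x,\alpha)=\{x^*\in B_{X^*}: x^*(x)>1-\alpha\}$ with $x\in S_X$ and $\alpha>0$. The dual space $X^*$ has the weak$^*$ symmetric strong diameter $2$ property ($w^*$-SSD$2$P) if, for every finite family $\{S_i\}_{i=1}^n$ of weak$^*$ slices of $B_{X^*}$ and every $\varepsilon>0$, there exist $f_i\in S_i$, $i=1,\ldots,n$, and $g\in B_{X^*}$ such that $f_i+g\in S_i$ and $f_i-g\in S_i$ for every $i\in\{1,\ldots,n\}$, and $\|g\|>1-\varepsilon$. A Banach space $X$ is decomposably octahedral (DOH) if, for every finite subset $E$ of $S_X$ and every $\varepsilon>0$, there exists $y\in S_X$ such that, for every $n\in\mathbb{N}$, all $y_1,\ldots,y_n\in X$ with $\sum_{i=1}^n y_i=y$, all $x_1,\ldots,x_n\in E$ (not necessarily distinct), and all real $a_1,b_1,\ldots,a_n,b_n\geq 0$, $$\sum_{i=1}^n\bigl(\|a_ix_i+y_i\|+\|b_ix_i-y_i\|\bigr)\geq(1-\varepsilon)\Bigl(\sum_{i=1}^n(a_i+b_i)+2\Bigr).$$ *)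

theory Defs
  imports "HOL-Analysis.Analysis"
begin

text \<open>
  The dual space of a real normed space \<^typ>\<open>'a\<close> is the type \<open>'a \<Rightarrow>\<^sub>L real\<close> of bounded linear
  functionals with the operator norm. Properties of a whole space are predicates on
  \<open>TYPE('a)\<close>.
\<close>

definition weak_star_slice :: "'a::real_normed_vector \<Rightarrow> real \<Rightarrow> ('a \<Rightarrow>\<^sub>L real) set" where
  "weak_star_slice x \<alpha> = {f \<in> cball 0 1. blinfun_apply f x > 1 - \<alpha>}"

definition is_weak_star_slice :: "('a::real_normed_vector \<Rightarrow>\<^sub>L real) set \<Rightarrow> bool" where
  "is_weak_star_slice S \<longleftrightarrow> (\<exists>x\<in>sphere 0 1. \<exists>\<alpha>>0. S = weak_star_slice x \<alpha>)"

text \<open>The type argument is the predual \<open>X\<close>; the property itself is one of \<open>X\<^sup>*\<close>.\<close>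

definition dual_weak_star_SSD2P :: "'a::real_normed_vector itself \<Rightarrow> bool" where
  "dual_weak_star_SSD2P TYPE('a) \<longleftrightarrow>
    (\<forall>(n::nat) (S :: nat \<Rightarrow> ('a \<Rightarrow>\<^sub>L real) set) (\<epsilon>::real).
      n \<ge> 1 \<longrightarrow> (\<forall>i\<in>{1..n}. is_weak_star_slice (S i)) \<longrightarrow> \<epsilon> > 0 \<longrightarrow>
      (\<exists>(f :: nat \<Rightarrow> 'a \<Rightarrow>\<^sub>L real) g.
        (\<forall>i\<in>{1..n}. f i \<in> S i) \<and> g \<in> cball 0 1 \<and>
        (\<forall>i\<in>{1..n}. f i + g \<in> S i \<and> f i - g \<in> S i) \<and>
        norm g > 1 - \<epsilon>))"

definition decomposably_octahedral :: "'a::real_normed_vector itself \<Rightarrow> bool" where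
  "decomposably_octahedral TYPE('a) \<longleftrightarrow>
    (\<forall>(E :: 'a set) (\<epsilon>::real). finite E \<longrightarrow> E \<subseteq> sphere 0 1 \<longrightarrow> \<epsilon> > 0 \<longrightarrow>
      (\<exists>y\<in>sphere 0 1. \<forall>(n::nat) (ys :: nat \<Rightarrow> 'a) (xs :: nat \<Rightarrow> 'a)
          (a :: nat \<Rightarrow> real) (b :: nat \<Rightarrow> real).
        n \<ge> 1 \<longrightarrow> (\<Sum>i=1..n. ys i) = y \<longrightarrow> (\<forall>i\<in>{1..n}. xs i \<in> E) \<longrightarrow>
        (\<forall>i\<in>{1..n}. a i \<ge> 0 \<and> b i \<ge> 0) \<longrightarrow>
        (\<Sum>i=1..n. norm (a i *\<^sub>R xs i + ys i) + norm (b i *\<^sub>R xs i - ys i))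
          \<ge> (1 - \<epsilon>) * ((\<Sum>i=1..n. a i + b i) + 2)))"

end

theory Submission
  imports Defs
begin

text \<open>
  Apply the SSD2P to the slices \<open>{f. f x > 1 - \<epsilon>}\<close>, \<open>x \<in> E\<close>. It yields one functional \<open>g\<close> of norm
  greater than \<open>1 - \<epsilon>\<close> and, for each \<open>x\<close>, a functional \<open>f\<^sub>x\<close> such that \<open>f\<^sub>x + g\<close> and \<open>f\<^sub>x - g\<close>
  both lie in the slice of \<open>x\<close>. Let \<open>y\<close> be a unit vector at which \<open>g\<close> exceeds \<open>1 - \<epsilon>\<close>. Testing
  \<open>a x + u\<close> with \<open>f\<^sub>x + g\<close> and \<open>b x - u\<close> with \<open>f\<^sub>x - g\<close>, the contributions of \<open>f\<^sub>x u\<close> cancel and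
  those of \<open>g u\<close> add up to \<open>2 g u\<close> (lemma \<open>norm_pair_ge\<close>). Since \<open>g\<close> does not depend on \<open>x\<close>,
  summation over any decomposition of \<open>y\<close> produces \<open>2 g y > 2 (1 - \<epsilon>)\<close>. This is why a single \<open>y\<close>
  serves all decompositions.
\<close>

lemma weak_star_sliceD:
  assumes "f \<in> weak_star_slice x \<alpha>"
  shows "norm f \<le> 1" and "1 - \<alpha> < blinfun_apply f x"
  using assms by (auto simp: weak_star_slice_def)

lemma blinfun_apply_le_norm:
  fixes f :: "'a::real_normed_vector \<Rightarrow>\<^sub>L real"
  assumes "norm f \<le> 1"
  shows "blinfun_apply f v \<le> norm v"
proof -
  have "norm (blinfun_apply f v) \<le> norm f * norm v"
    by (rule norm_blinfun)
  also have "\<dots> \<le> 1 * norm v"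
    by (intro mult_right_mono assms norm_ge_zero)
  finally show ?thesis by simp
qed

lemma unit_vector_exists:
  assumes "(UNIV :: 'a::real_normed_vector set) \<noteq> {0}"
  shows "\<exists>z::'a. norm z = 1"
proof -
  obtain v :: 'a where "v \<noteq> 0" using assms by auto
  then have "norm (sgn v) = 1" by (simp add: norm_sgn)
  then show ?thesis ..
qed

text \<open>
  The supremum of a functional over the unit sphere is its norm, because the sphere is symmetric.
  The sphere must be nonempty: this makes the statement true for negative \<open>c\<close> as well.
\<close>

lemma norming_unit_vector:
  fixes g :: "'a::real_normed_vector \<Rightarrow>\<^sub>L real"
  assumes nontrivial: "(UNIV :: 'a set) \<noteq> {0}" and "c < norm g"
  shows "\<exists>y. norm y = 1 \<and> c < blinfun_apply g y"
proof (rule ccontr)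
  assume "\<not> ?thesis"
  then have le: "blinfun_apply g y \<le> c" if "norm y = 1" for y
    using that by force
  have abs_le: "\<bar>blinfun_apply g y\<bar> \<le> c" if "norm y = 1" for y
    using le[of y] le[of "- y"] that by (simp add: blinfun.minus_right)
  obtain z :: 'a where "norm z = 1"
    using unit_vector_exists[OF nontrivial] by blast
  then have "0 \<le> c" using abs_le[of z] by simp
  moreover have "norm (blinfun_apply g v) \<le> c * norm v" for v
  proof (cases "v = 0")
    case False
    then have "\<bar>blinfun_apply g (sgn v)\<bar> \<le> c"
      by (intro abs_le) (simp add: norm_sgn)
    with False show ?thesis
      by (simp add: sgn_div_norm blinfun.scaleR_right abs_mult field_simps)
  qed simp
  ultimately have "norm g \<le> c" by (rule norm_blinfun_bound)
  with \<open>c < norm g\<close> show False by simp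
qed

text \<open>
  The two norms are bounded below by the values of \<open>f + g\<close> and \<open>f - g\<close>. In the sum of these
  values \<open>f u\<close> cancels, so the bound depends on \<open>u\<close> only through \<open>g\<close>.
\<close>

lemma norm_pair_ge:
  fixes f g :: "'a::real_normed_vector \<Rightarrow>\<^sub>L real"
  assumes plus: "f + g \<in> weak_star_slice x \<alpha>" and minus: "f - g \<in> weak_star_slice x \<alpha>"
    and "0 \<le> a" "0 \<le> b"
  shows "(1 - \<alpha>) * (a + b) + 2 * blinfun_apply g u
           \<le> norm (a *\<^sub>R x + u) + norm (b *\<^sub>R x - u)"
proof -
  have "(1 - \<alpha>) * (a + b) + 2 * blinfun_apply g u
      \<le> a * blinfun_apply (f + g) x + b * blinfun_apply (f - g) x + 2 * blinfun_apply g u"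
    using mult_left_mono[OF less_imp_le[OF weak_star_sliceD(2)[OF plus]] \<open>0 \<le> a\<close>]
      mult_left_mono[OF less_imp_le[OF weak_star_sliceD(2)[OF minus]] \<open>0 \<le> b\<close>]
    by (simp add: algebra_simps)
  also have "\<dots> = blinfun_apply (f + g) (a *\<^sub>R x + u) + blinfun_apply (f - g) (b *\<^sub>R x - u)"
    by (simp add: blinfun.add_left blinfun.diff_left blinfun.add_right blinfun.diff_right
        blinfun.scaleR_right algebra_simps)
  also have "\<dots> \<le> norm (a *\<^sub>R x + u) + norm (b *\<^sub>R x - u)"
    by (intro add_mono blinfun_apply_le_norm weak_star_sliceD(1)[OF plus]
        weak_star_sliceD(1)[OF minus])
  finally show ?thesis .
qed

text \<open>
  The form in which the SSD2P is used: slices indexed by the points of a finite set instead of by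
  an initial segment of the natural numbers.
\<close>

lemma SSD2P_slices_of_finite_set:
  fixes E :: "'a::real_normed_vector set"
  assumes "dual_weak_star_SSD2P TYPE('a)"
    and "finite E" "E \<noteq> {}" "E \<subseteq> sphere 0 1" "0 < \<epsilon>"
  obtains f :: "'a \<Rightarrow> 'a \<Rightarrow>\<^sub>L real" and g
  where "\<And>x. x \<in> E \<Longrightarrow> f x + g \<in> weak_star_slice x \<epsilon>"
    and "\<And>x. x \<in> E \<Longrightarrow> f x - g \<in> weak_star_slice x \<epsilon>"
    and "1 - \<epsilon> < norm g"
proof -
  obtain h where h: "bij_betw h {1..card E} E"
    using ex_bij_betw_nat_finite_1[OF \<open>finite E\<close>] by blast
  have "1 \<le> card E"
    using \<open>finite E\<close> \<open>E \<noteq> {}\<close> by (simp add: Suc_le_eq card_gt_0_iff)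
  moreover have "\<forall>i\<in>{1..card E}. is_weak_star_slice (weak_star_slice (h i) \<epsilon>)"
    using bij_betwE[OF h] \<open>E \<subseteq> sphere 0 1\<close> \<open>0 < \<epsilon>\<close>
    unfolding is_weak_star_slice_def by blast
  ultimately obtain F :: "nat \<Rightarrow> 'a \<Rightarrow>\<^sub>L real" and g
    where F: "\<forall>i\<in>{1..card E}. F i + g \<in> weak_star_slice (h i) \<epsilon>
                \<and> F i - g \<in> weak_star_slice (h i) \<epsilon>"
      and g: "1 - \<epsilon> < norm g"
    using assms(1)[unfolded dual_weak_star_SSD2P_def, rule_format,
        of "card E" "\<lambda>i. weak_star_slice (h i) \<epsilon>" \<epsilon>] \<open>0 < \<epsilon>\<close>
    by blast
  define k where "k = inv_into {1..card E} h"
  have k: "k x \<in> {1..card E}" "h (k x) = x" if "x \<in> E" for x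
    using that h unfolding k_def
    by (auto simp: bij_betw_def intro: inv_into_into f_inv_into_f simp del: atLeastAtMost_iff)
  show thesis
    by (rule that[of "F \<circ> k" g]) (use F k g in \<open>force+\<close>)
qed

theorem proposition2p1:
  assumes "(UNIV :: 'a::banach set) \<noteq> {0}"
    and "dual_weak_star_SSD2P TYPE('a)"
  shows "decomposably_octahedral TYPE('a)"
  unfolding decomposably_octahedral_def
proof (intro allI impI)
  fix E :: "'a set" and \<epsilon> :: real
  assume E: "finite E" "E \<subseteq> sphere 0 1" and "0 < \<epsilon>"
  obtain z :: 'a where "norm z = 1"
    using unit_vector_exists[OF assms(1)] by blast
  \<comment> \<open>The point \<open>z\<close> is added because \<open>E\<close> may be empty, whereas the SSD2P concerns at least one slice.\<close>
  with E \<open>0 < \<epsilon>\<close> obtain f :: "'a \<Rightarrow> 'a \<Rightarrow>\<^sub>L real" and g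
    where f: "\<And>x. x \<in> insert z E \<Longrightarrow> f x + g \<in> weak_star_slice x \<epsilon>"
        "\<And>x. x \<in> insert z E \<Longrightarrow> f x - g \<in> weak_star_slice x \<epsilon>"
      and "1 - \<epsilon> < norm g"
    using SSD2P_slices_of_finite_set[OF assms(2), of "insert z E" \<epsilon>] by auto
  then obtain y where "norm y = 1" and gy: "1 - \<epsilon> < blinfun_apply g y"
    using norming_unit_vector[OF assms(1)] by blast
  show "\<exists>y\<in>sphere 0 1. \<forall>(n::nat) (ys :: nat \<Rightarrow> 'a) (xs :: nat \<Rightarrow> 'a)
          (a :: nat \<Rightarrow> real) (b :: nat \<Rightarrow> real).
        n \<ge> 1 \<longrightarrow> (\<Sum>i=1..n. ys i) = y \<longrightarrow> (\<forall>i\<in>{1..n}. xs i \<in> E) \<longrightarrow>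
        (\<forall>i\<in>{1..n}. a i \<ge> 0 \<and> b i \<ge> 0) \<longrightarrow>
        (\<Sum>i=1..n. norm (a i *\<^sub>R xs i + ys i) + norm (b i *\<^sub>R xs i - ys i))
          \<ge> (1 - \<epsilon>) * ((\<Sum>i=1..n. a i + b i) + 2)"
  proof (intro bexI[of _ y] allI impI)
    show "y \<in> sphere 0 1" using \<open>norm y = 1\<close> by simp
  next
    fix n :: nat and ys xs :: "nat \<Rightarrow> 'a" and a b :: "nat \<Rightarrow> real"
    assume ys: "(\<Sum>i=1..n. ys i) = y" and xs: "\<forall>i\<in>{1..n}. xs i \<in> E"
      and ab: "\<forall>i\<in>{1..n}. a i \<ge> 0 \<and> b i \<ge> 0"
    have "(1 - \<epsilon>) * ((\<Sum>i=1..n. a i + b i) + 2)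
        \<le> (1 - \<epsilon>) * (\<Sum>i=1..n. a i + b i) + 2 * blinfun_apply g y"
      using gy by (simp add: algebra_simps)
    also have "\<dots> = (\<Sum>i=1..n. (1 - \<epsilon>) * (a i + b i) + 2 * blinfun_apply g (ys i))"
      unfolding ys[symmetric] blinfun.sum_right sum.distrib[of "\<lambda>i. (1 - \<epsilon>) * (a i + b i)"]
        sum_distrib_left ..
    also have "\<dots> \<le> (\<Sum>i=1..n. norm (a i *\<^sub>R xs i + ys i) + norm (b i *\<^sub>R xs i - ys i))"
    proof (intro sum_mono)
      fix i assume "i \<in> {1..n}"
      then show "(1 - \<epsilon>) * (a i + b i) + 2 * blinfun_apply g (ys i)
          \<le> norm (a i *\<^sub>R xs i + ys i) + norm (b i *\<^sub>R xs i - ys i)"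
        using xs ab by (intro norm_pair_ge[of "f (xs i)"] f) auto
    qed
    finally show "(\<Sum>i=1..n. norm (a i *\<^sub>R xs i + ys i) + norm (b i *\<^sub>R xs i - ys i))
        \<ge> (1 - \<epsilon>) * ((\<Sum>i=1..n. a i + b i) + 2)" .
  qed
qed

end
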